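(* Let $(D,E)$ be a non-ball cut in an ordered abelian group $\Gamma$, with invariance group $H$. (1) If $(D,E)$ has a convexity gap, then $H\subsetneq V_f(D)=V_i(E)$ and the covariance groups $V_f(D)$, $V_i(E)$ are stable. (2) If $(D,E)$ does not have a convexity gap, then $H=V_f(D)=V_i(E)$ and the covariance groups $V_f(D)$, $V_i(E)$ are unstable.
   Context: A cut in $\Gamma$ is a pair $(D,E)$ of subsets with $D<E$ and $D\cup E=\Gamma$. It is principal if it is of the form $(\Gamma_{\le a},\Gamma_{>a})$ or $(\Gamma_{<a},\Gamma_{\ge a})$ for some $a\in\Gamma$. Its invariance group is the convex subgroup $H=H(D)=\{h\in\Gamma\mid D+h=D\}$ (with $\emptyset+h=\emptyset$). It is a ball cut if the cut $(D/H,E/H)$ in the ordered quotient group $\Gamma/H$ is principal; otherwise it is a non-ball cut (improper cuts are ball cuts). The cut has a convexity gap if $H(D)$ has an immediate successor in the set of all convex subgroups of $\Gamma$ ordered by inclusion. Equivalently, the set $\{H_i\supsetneq H(D)\}$ of nonzero principal convex subgroups (those generated by one element) strictly containing $H(D)$ has a smallest element with respect to inclusion. For $D\subset\Gamma$ and $d\in D$, let $V_f(D,d)$ be the convex subgroup of $\Gamma$ generated by $\{d'-d\mid d'\in D,\ d'\ge d\}$, and $V_f(D)=\bigcap_{d\in D}V_f(D,d)$. $V_f(D)$ is stable if $V_f(D)=V_f(D,d)$ for some $d\in D$, and unstable otherwise. Dually, for $E\subset\Gamma$ and $e\in E$, let $V_f(E^{\mathrm{opp}},e)$ be the convex subgroup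 generated by $\{e-e'\mid e'\in E,\ e'\le e\}$, and $V_i(E)=\bigcap_{e\in E}V_f(E^{\mathrm{opp}},e)$. $V_i(E)$ is stable if $V_i(E)=V_f(E^{\mathrm{opp}},e)$ for some $e\in E$, and unstable otherwise. *)

theory Defs
  imports "HOL.Hull" "HOL-Library.Set_Algebras"
begin

section \<open>Convex subgroups\<close>

definition convex_subgroup :: "'a::linordered_ab_group_add set \<Rightarrow> bool" where
  "convex_subgroup H \<longleftrightarrow>
     0 \<in> H \<and> (\<forall>x\<in>H. \<forall>y\<in>H. x + y \<in> H) \<and> (\<forall>x\<in>H. - x \<in> H) \<and>
     (\<forall>x\<in>H. \<forall>z\<in>H. \<forall>y. x \<le> y \<and> y \<le> z \<longrightarrow> y \<in> H)"

lemma convex_subgroupD: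
  assumes "convex_subgroup H"
  shows "0 \<in> H" "x \<in> H \<Longrightarrow> y \<in> H \<Longrightarrow> x + y \<in> H" "x \<in> H \<Longrightarrow> - x \<in> H"
    "x \<in> H \<Longrightarrow> z \<in> H \<Longrightarrow> x \<le> y \<Longrightarrow> y \<le> z \<Longrightarrow> y \<in> H"
  using assms unfolding convex_subgroup_def by (elim conjE; blast)+

text \<open>The convex subgroup generated by \<open>S\<close> is \<open>convex_subgroup hull S\<close>; the following
  lemma shows that the hull is indeed a convex subgroup.\<close>

lemma convex_subgroup_hull:
  fixes S :: "'a::linordered_ab_group_add set"
  shows "convex_subgroup (convex_subgroup hull S)"
proof (rule hull_in)
  fix T :: "'a set set"
  assume "Ball T convex_subgroup"
  then have "convex_subgroup H" if "H \<in> T" for H using that by blast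
  note closed = convex_subgroupD[OF this]
  show "convex_subgroup (\<Inter> T)"
    unfolding convex_subgroup_def
  proof (intro conjI ballI allI impI InterI)
    fix x y z H assume "x \<in> \<Inter> T" "z \<in> \<Inter> T" "x \<le> y \<and> y \<le> z" "H \<in> T"
    then show "y \<in> H" using closed(4)[of H x z y] by blast
  qed (use closed(1-3) in blast)+
qed


section \<open>Cuts\<close>

text \<open>Cuts are needed both in the group and in its ordered quotient by a convex subgroup
  that depends on the cut. The quotient is not a type, so the notions
  take a carrier \<open>C\<close> and a total order \<open>le\<close> on it as parameters.\<close>

definition is_cut :: "'b set \<Rightarrow> ('b \<Rightarrow> 'b \<Rightarrow> bool) \<Rightarrow> 'b set \<Rightarrow> 'b set \<Rightarrow> bool" where
  "is_cut C le D E \<longleftrightarrow> (\<forall>d\<in>D. \<forall>e\<in>E. le d e \<and> d \<noteq> e) \<and> D \<union> E = C"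

definition is_principal_cut :: "'b set \<Rightarrow> ('b \<Rightarrow> 'b \<Rightarrow> bool) \<Rightarrow> 'b set \<Rightarrow> 'b set \<Rightarrow> bool" where
  "is_principal_cut C le D E \<longleftrightarrow> is_cut C le D E \<and>
     (\<exists>a\<in>C. (D = {x\<in>C. le x a} \<and> E = {x\<in>C. le a x \<and> x \<noteq> a}) \<or>
             (D = {x\<in>C. le x a \<and> x \<noteq> a} \<and> E = {x\<in>C. le a x}))"

definition invariance_group :: "'a::linordered_ab_group_add set \<Rightarrow> 'a set" where
  "invariance_group D = {h. (\<lambda>d. d + h) ` D = D}"


section \<open>The ordered quotient group\<close>

text \<open>\<open>image_mod D H\<close> is the image \<open>D/H\<close> of \<open>D\<close> in the quotient by \<open>H\<close>; in particular
  \<open>image_mod UNIV H\<close> is the quotient itself, as the set of cosets of \<open>H\<close>.\<close>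

definition image_mod :: "'a::linordered_ab_group_add set \<Rightarrow> 'a set \<Rightarrow> 'a set set" where
  "image_mod D H = (\<lambda>x. x +o H) ` D"

definition coset_le :: "'a::linordered_ab_group_add set \<Rightarrow> 'a set \<Rightarrow> bool" where
  "coset_le X Y \<longleftrightarrow> (\<exists>x\<in>X. \<exists>y\<in>Y. x \<le> y)"

definition ball_cut :: "'a::linordered_ab_group_add set \<Rightarrow> 'a set \<Rightarrow> bool" where
  "ball_cut D E \<longleftrightarrow> is_cut UNIV (\<le>) D E \<and>
     (let H = invariance_group D
      in is_principal_cut (image_mod UNIV H) coset_le (image_mod D H) (image_mod E H))"

definition non_ball_cut :: "'a::linordered_ab_group_add set \<Rightarrow> 'a set \<Rightarrow> bool" where
  "non_ball_cut D E \<longleftrightarrow> is_cut UNIV (\<le>) D E \<and> \<not> ball_cut D E"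


subsection \<open>Well-definedness of the quotient order and of the quotient cut\<close>

lemma coset_eq_iff:
  assumes "convex_subgroup H"
  shows "x +o H = y +o H \<longleftrightarrow> x - y \<in> H"
proof
  assume eq: "x +o H = y +o H"
  have "x \<in> x +o H" using convex_subgroupD(1)[OF assms] unfolding elt_set_plus_def by force
  then show "x - y \<in> H" unfolding eq by (auto simp: elt_set_plus_def)
next
  have sub: "u +o H \<subseteq> v +o H" if "u - v \<in> H" for u v
  proof
    fix z assume "z \<in> u +o H"
    then obtain h where "h \<in> H" "z = u + h" by (auto simp: elt_set_plus_def)
    then have "(u - v) + h \<in> H" "z = v + ((u - v) + h)"
      using convex_subgroupD(2)[OF assms] that by auto
    then show "z \<in> v +o H" unfolding elt_set_plus_def by blast
  qed
  assume "x - y \<in> H"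
  moreover from this have "y - x \<in> H"
    using convex_subgroupD(3)[OF assms] by fastforce
  ultimately show "x +o H = y +o H" using sub by blast
qed

lemma coset_le_iff:
  assumes "convex_subgroup H"
  shows "coset_le (x +o H) (y +o H) \<longleftrightarrow> x \<le> y \<or> x - y \<in> H"
proof
  assume "coset_le (x +o H) (y +o H)"
  then obtain h k where hk: "h \<in> H" "k \<in> H" "x + h \<le> y + k"
    by (auto simp: coset_le_def elt_set_plus_def)
  have "x - y \<in> H" if "\<not> x \<le> y"
  proof -
    have "0 \<le> x - y" using that by simp
    moreover have "x - y \<le> k + - h" using hk(3) by (simp add: algebra_simps)
    moreover have "k + - h \<in> H" "0 \<in> H" using convex_subgroupD[OF assms] hk by blast+
    ultimately show ?thesis using convex_subgroupD(4)[OF assms] by blast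
  qed
  then show "x \<le> y \<or> x - y \<in> H" by blast
next
  have 0: "0 \<in> H" by (rule convex_subgroupD(1)[OF assms])
  assume "x \<le> y \<or> x - y \<in> H"
  then show "coset_le (x +o H) (y +o H)"
  proof
    assume "x \<le> y"
    with 0 show ?thesis unfolding coset_le_def elt_set_plus_def by force
  next
    assume "x - y \<in> H"
    then have "x + 0 = y + (x - y)" by simp
    with 0 \<open>x - y \<in> H\<close> show ?thesis unfolding coset_le_def elt_set_plus_def
      by (metis (mono_tags, lifting) mem_Collect_eq order_refl)
  qed
qed

lemma mem_cut_mono:
  fixes D E :: "'a::linorder set"
  assumes "is_cut UNIV (\<le>) D E" "d \<in> D" "x \<le> d"
  shows "x \<in> D"
proof (rule ccontr)
  assume "x \<notin> D"
  then have "x \<in> E" using assms(1) unfolding is_cut_def by blast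
  then have "d \<le> x" "d \<noteq> x" using assms(1,2) unfolding is_cut_def by simp_all
  with assms(3) show False by simp
qed

lemma convex_subgroup_invariance_group:
  assumes "is_cut UNIV (\<le>) D E"
  shows "convex_subgroup (invariance_group D)"
proof -
  have iff: "h \<in> invariance_group D \<longleftrightarrow> (\<forall>d. d \<in> D \<longleftrightarrow> d + h \<in> D)" for h
  proof
    assume h: "h \<in> invariance_group D"
    show "\<forall>d. d \<in> D \<longleftrightarrow> d + h \<in> D"
    proof (intro allI iffI)
      fix d assume "d \<in> D" then show "d + h \<in> D" using h by (auto simp: invariance_group_def)
    next
      fix d assume "d + h \<in> D"
      then obtain d' where "d' \<in> D" "d + h = d' + h"
        using h unfolding invariance_group_def by (metis (mono_tags, lifting) image_iff mem_Collect_eq)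
      then show "d \<in> D" by simp
    qed
  next
    assume h: "\<forall>d. d \<in> D \<longleftrightarrow> d + h \<in> D"
    have "d \<in> (\<lambda>d. d + h) ` D" if "d \<in> D" for d
      using h[rule_format, of "d - h"] that by (intro image_eqI[where x = "d - h"]) simp_all
    moreover have "(\<lambda>d. d + h) ` D \<subseteq> D" using h by blast
    ultimately show "h \<in> invariance_group D" unfolding invariance_group_def by blast
  qed
  show ?thesis unfolding convex_subgroup_def
  proof (intro conjI ballI allI impI)
    show "0 \<in> invariance_group D" by (simp add: iff)
  next
    fix x y assume "x \<in> invariance_group D" "y \<in> invariance_group D"
    then show "x + y \<in> invariance_group D" by (simp add: iff flip: add.assoc)
  next
    fix x assume x: "x \<in> invariance_group D"
    show "- x \<in> invariance_group D" unfolding iff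
    proof
      fix d show "d \<in> D \<longleftrightarrow> d + - x \<in> D"
        using x[unfolded iff, rule_format, of "d - x"] by simp
    qed
  next
    fix x z y assume x: "x \<in> invariance_group D" and z: "z \<in> invariance_group D"
      and "x \<le> y \<and> y \<le> z"
    then have "d + x \<le> d + y" "d + y \<le> d + z" for d by auto
    then show "y \<in> invariance_group D"
      using x z mem_cut_mono[OF assms] unfolding iff by metis
  qed
qed

lemma is_cut_quotient:
  assumes cut: "is_cut UNIV (\<le>) D E" and H: "H = invariance_group D"
  shows "is_cut (image_mod UNIV H) coset_le (image_mod D H) (image_mod E H)"
proof -
  have cs: "convex_subgroup H" using convex_subgroup_invariance_group[OF cut] H by simp
  have "coset_le (d +o H) (e +o H) \<and> d +o H \<noteq> e +o H" if "d \<in> D" "e \<in> E" for d e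
  proof -
    have le: "d \<le> e" using cut that unfolding is_cut_def by blast
    have "e \<notin> D" using cut that unfolding is_cut_def by blast
    moreover have "e \<in> D" if "d - e \<in> H"
    proof -
      have "- (d - e) \<in> H" using convex_subgroupD(3)[OF cs that] .
      then have "(\<lambda>d. d + (e - d')) ` D = D" if "d' = d" for d'
        using that by (simp add: H invariance_group_def)
      then have "d + (e - d) \<in> D" using \<open>d \<in> D\<close> by blast
      then show ?thesis by simp
    qed
    ultimately show ?thesis using le unfolding coset_le_iff[OF cs] coset_eq_iff[OF cs] by blast
  qed
  moreover have "image_mod D H \<union> image_mod E H = image_mod UNIV H"
    using cut unfolding is_cut_def image_mod_def by (metis image_Un)
  ultimately show ?thesis unfolding is_cut_def image_mod_def by blast
qed

lemma improper_cut_ball_cut: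
  "ball_cut {} (UNIV :: 'a::linordered_ab_group_add set)"
  "ball_cut (UNIV :: 'a set) {}"
proof -
  have surj: "range (\<lambda>d. d + h) = UNIV" for h :: 'a
    by (metis diff_add_cancel surjI)
  then have inv: "invariance_group {} = (UNIV :: 'a set)" "invariance_group UNIV = (UNIV :: 'a set)"
    by (simp_all add: invariance_group_def)
  have "x +o UNIV = UNIV" for x :: 'a
  proof -
    have "x +o UNIV = range (\<lambda>d. d + x)"
      unfolding elt_set_plus_def image_def by (simp add: add.commute)
    then show ?thesis using surj by simp
  qed
  then have mod: "image_mod UNIV UNIV = {UNIV :: 'a set}" "image_mod {} UNIV = ({} :: 'a set set)"
    by (simp_all add: image_mod_def)
  have "coset_le UNIV (UNIV :: 'a set)" by (auto simp: coset_le_def)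
  then show "ball_cut {} (UNIV :: 'a set)" "ball_cut (UNIV :: 'a set) {}"
    by (auto simp: ball_cut_def inv mod is_cut_def is_principal_cut_def)
qed


section \<open>Convexity gaps and covariance groups\<close>

definition has_convexity_gap :: "'a::linordered_ab_group_add set \<Rightarrow> bool" where
  "has_convexity_gap D \<longleftrightarrow>
     (\<exists>K. convex_subgroup K \<and> invariance_group D \<subset> K \<and>
          (\<nexists>L. convex_subgroup L \<and> invariance_group D \<subset> L \<and> L \<subset> K))"

definition Vf_at :: "'a::linordered_ab_group_add set \<Rightarrow> 'a \<Rightarrow> 'a set" where
  "Vf_at D d = convex_subgroup hull {d' - d | d'. d' \<in> D \<and> d \<le> d'}"

definition Vf :: "'a::linordered_ab_group_add set \<Rightarrow> 'a set" where
  "Vf D = (\<Inter>d\<in>D. Vf_at D d)"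

definition Vf_stable :: "'a::linordered_ab_group_add set \<Rightarrow> bool" where
  "Vf_stable D \<longleftrightarrow> (\<exists>d\<in>D. Vf D = Vf_at D d)"

text \<open>\<open>Vf_opp_at E e\<close> is \<open>Vf_at\<close> for \<open>E\<close> in the group with the opposite order, the
  generators being written as non-negative elements.\<close>

definition Vf_opp_at :: "'a::linordered_ab_group_add set \<Rightarrow> 'a \<Rightarrow> 'a set" where
  "Vf_opp_at E e = convex_subgroup hull {e - e' | e'. e' \<in> E \<and> e' \<le> e}"

definition Vi :: "'a::linordered_ab_group_add set \<Rightarrow> 'a set" where
  "Vi E = (\<Inter>e\<in>E. Vf_opp_at E e)"

definition Vi_stable :: "'a::linordered_ab_group_add set \<Rightarrow> bool" where
  "Vi_stable E \<longleftrightarrow> (\<exists>e\<in>E. Vi E = Vf_opp_at E e)"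

end

theory Submission
  imports Defs
begin

text \<open>
  Let \<open>I\<close> be the intersection of all convex subgroups strictly containing the invariance
  group \<open>H\<close>. As convex subgroups form a chain, the cut has a convexity gap exactly when
  \<open>I \<noteq> H\<close>, and in that case \<open>I\<close> is the immediate successor of \<open>H\<close>
  (\<open>has_convexity_gap_iff\<close>).

  For a non-ball cut, both families \<open>Vf_at D d\<close> (\<open>d \<in> D\<close>) and \<open>Vf_opp_at E e\<close> (\<open>e \<in> E\<close>)
  consist of convex subgroups strictly above \<open>H\<close>, and both are coinitial among these: every convex
  subgroup strictly above \<open>H\<close> contains a member of the family.

  \<^item> They lie strictly above \<open>H\<close> because \<open>Vf_at D d = H\<close> would make the coset of \<open>d\<close> the
    greatest element of \<open>D/H\<close>, and the quotient cut would be principal; dually for \<open>E\<close>.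
  \<^item> They are coinitial because any convex \<open>K\<close> strictly above \<open>H\<close> contains some \<open>k > 0\<close>
    outside \<open>H\<close>, and such a \<open>k\<close> carries some \<open>d \<in> D\<close> across the cut to \<open>d + k \<in> E\<close>. The
    part of \<open>D\<close> above \<open>d\<close> and the part of \<open>E\<close> below \<open>d + k\<close> then lie in an interval of length
    \<open>k\<close>, so \<open>Vf_at D d\<close> and \<open>Vf_opp_at E (d + k)\<close> are contained in \<open>K\<close>.

  A coinitial family has intersection \<open>I\<close>, and it attains this intersection exactly when \<open>I\<close>
  itself lies strictly above \<open>H\<close> (\<open>coinitial_family_Inter\<close>, \<open>coinitial_family_attains_iff\<close>).
  So \<open>Vf D = Vi E = I\<close>, and stability of either is equivalent to the convexity gap.
\<close>

section \<open>The chain of convex subgroups\<close>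

lemma convex_subgroup_Inter:
  assumes "\<And>H. H \<in> T \<Longrightarrow> convex_subgroup H"
  shows "convex_subgroup (\<Inter>T)"
proof -
  have "convex_subgroup hull \<Inter>T \<subseteq> H" if "H \<in> T" for H
    by (rule hull_minimal) (use assms that in blast)+
  then have "convex_subgroup hull \<Inter>T = \<Inter>T" using hull_subset[of "\<Inter>T"] by blast
  then show ?thesis using convex_subgroup_hull by metis
qed

lemma convex_subgroup_subsetI:
  assumes "convex_subgroup H" "convex_subgroup K"
    and "\<And>x. x \<in> H \<Longrightarrow> 0 \<le> x \<Longrightarrow> x \<in> K"
  shows "H \<subseteq> K"
proof
  fix x assume x: "x \<in> H"
  show "x \<in> K"
  proof (cases "0 \<le> x")
    case False
    then have "- x \<in> K" using assms(3) convex_subgroupD(3)[OF assms(1) x] by simp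
    then show ?thesis using convex_subgroupD(3)[OF assms(2), of "- x"] by simp
  qed (use assms(3) x in blast)
qed

lemma convex_subgroups_linear:
  assumes "convex_subgroup H" "convex_subgroup K"
  shows "H \<subseteq> K \<or> K \<subseteq> H"
proof (rule disjCI)
  assume "\<not> K \<subseteq> H"
  then obtain k where k: "k \<in> K" "0 \<le> k" "k \<notin> H"
    using convex_subgroup_subsetI[OF assms(2,1)] by blast
  show "H \<subseteq> K"
  proof (rule convex_subgroup_subsetI[OF assms])
    fix x assume x: "x \<in> H" "0 \<le> x"
    have "\<not> k \<le> x"
      using convex_subgroupD(4)[OF assms(1) convex_subgroupD(1)[OF assms(1)] x(1) k(2)] k(3)
      by blast
    then show "x \<in> K"
      using convex_subgroupD(4)[OF assms(2) convex_subgroupD(1)[OF assms(2)] k(1) x(2)] by simp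
  qed
qed

definition convex_above :: "'a::linordered_ab_group_add set \<Rightarrow> 'a set set" where
  "convex_above H = {K. convex_subgroup K \<and> H \<subset> K}"

text \<open>By linearity of the chain, a convex subgroup minimal strictly above \<open>H\<close> lies below all
  others, hence equals the intersection.\<close>

lemma has_convexity_gap_iff:
  "has_convexity_gap D \<longleftrightarrow> invariance_group D \<subset> \<Inter>(convex_above (invariance_group D))"
  (is "_ \<longleftrightarrow> ?H \<subset> ?I")
proof
  assume "has_convexity_gap D"
  then obtain K where K: "convex_subgroup K" "?H \<subset> K"
    and min: "\<nexists>L. convex_subgroup L \<and> ?H \<subset> L \<and> L \<subset> K"
    unfolding has_convexity_gap_def by blast
  have "K \<subseteq> L" if "L \<in> convex_above ?H" for L
  proof -
    have L: "convex_subgroup L" "?H \<subset> L" using that by (simp_all add: convex_above_def)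
    then have "\<not> L \<subset> K" using min by blast
    then show ?thesis using convex_subgroups_linear[OF K(1) L(1)] by (auto simp: psubset_eq)
  qed
  then have "K \<subseteq> ?I" by blast
  with K(2) show "?H \<subset> ?I" by blast
next
  assume "?H \<subset> ?I"
  moreover have "convex_subgroup ?I"
    by (rule convex_subgroup_Inter) (simp add: convex_above_def)
  moreover have "\<nexists>L. convex_subgroup L \<and> ?H \<subset> L \<and> L \<subset> ?I"
    unfolding convex_above_def by blast
  ultimately show "has_convexity_gap D" unfolding has_convexity_gap_def by blast
qed

lemma coinitial_family_Inter:
  assumes "\<And>s. s \<in> S \<Longrightarrow> V s \<in> convex_above H"
    and "\<And>K. K \<in> convex_above H \<Longrightarrow> \<exists>s\<in>S. V s \<subseteq> K"
  shows "(\<Inter>s\<in>S. V s) = \<Inter>(convex_above H)"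
  using assms by blast

text \<open>The intersection is a convex subgroup containing \<open>H\<close>; as soon as it is strictly larger,
  coinitiality puts a member of the family below it.\<close>

lemma coinitial_family_attains_iff:
  assumes above: "\<And>s. s \<in> S \<Longrightarrow> V s \<in> convex_above H"
    and coinitial: "\<And>K. K \<in> convex_above H \<Longrightarrow> \<exists>s\<in>S. V s \<subseteq> K"
  shows "(\<exists>s\<in>S. (\<Inter>s\<in>S. V s) = V s) \<longleftrightarrow> H \<subset> \<Inter>(convex_above H)"
proof -
  let ?I = "\<Inter>(convex_above H)"
  have Inter: "(\<Inter>s\<in>S. V s) = ?I"
    by (rule coinitial_family_Inter) (fact above, fact coinitial)
  show ?thesis unfolding Inter
  proof
    assume "\<exists>s\<in>S. ?I = V s"
    then obtain s where "s \<in> S" "?I = V s" by (elim bexE)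
    then show "H \<subset> ?I" using above[of s] by (simp add: convex_above_def)
  next
    assume "H \<subset> ?I"
    moreover have "convex_subgroup ?I"
      by (rule convex_subgroup_Inter) (simp add: convex_above_def)
    ultimately have "?I \<in> convex_above H" by (simp add: convex_above_def)
    then obtain s where s: "s \<in> S" "V s \<subseteq> ?I" using coinitial by blast
    moreover have "?I \<subseteq> V s" using above[OF s(1)] by (rule Inter_lower)
    ultimately show "\<exists>s\<in>S. ?I = V s" by (intro bexI[of _ s] equalityI)
  qed
qed


section \<open>Quotient cuts with an extremal element\<close>

lemma principal_cut_if_greatest:
  assumes "is_cut C le D E" "antisymp_on C le" "a \<in> D" "\<And>x. x \<in> D \<Longrightarrow> le x a"
  shows "is_principal_cut C le D E"
proof -
  have "D = {x\<in>C. le x a}" "E = {x\<in>C. le a x \<and> x \<noteq> a}" "a \<in> C"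
    using assms unfolding is_cut_def antisymp_on_def by blast+
  then show ?thesis using assms(1) unfolding is_principal_cut_def by blast
qed

lemma principal_cut_if_least:
  assumes "is_cut C le D E" "antisymp_on C le" "a \<in> E" "\<And>x. x \<in> E \<Longrightarrow> le a x"
  shows "is_principal_cut C le D E"
proof -
  have "D = {x\<in>C. le x a \<and> x \<noteq> a}" "E = {x\<in>C. le a x}" "a \<in> C"
    using assms unfolding is_cut_def antisymp_on_def by blast+
  then show ?thesis using assms(1) unfolding is_principal_cut_def by blast
qed

lemma antisymp_on_coset_le:
  assumes "convex_subgroup H"
  shows "antisymp_on (image_mod UNIV H) coset_le"
proof -
  have "x +o H = y +o H" if "coset_le (x +o H) (y +o H)" "coset_le (y +o H) (x +o H)" for x y
    using that convex_subgroupD(1)[OF assms] convex_subgroupD(3)[OF assms, of "y - x"]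
    unfolding coset_le_iff[OF assms] coset_eq_iff[OF assms] by fastforce
  then show ?thesis unfolding antisymp_on_def image_mod_def by blast
qed

text \<open>If no element of \<open>D\<close> exceeds \<open>d\<close> by more than an element of the invariance group, the
  coset of \<open>d\<close> is greatest in the lower half of the quotient cut.\<close>

lemma ball_cut_if_lower_ray_mod:
  assumes cut: "is_cut UNIV (\<le>) D E" and d: "d \<in> D"
    and ray: "\<And>d'. d' \<in> D \<Longrightarrow> d \<le> d' \<Longrightarrow> d' - d \<in> invariance_group D"
  shows "ball_cut D E"
proof -
  let ?H = "invariance_group D"
  have H: "convex_subgroup ?H" by (rule convex_subgroup_invariance_group[OF cut])
  have "coset_le (x +o ?H) (d +o ?H)" if "x \<in> D" for x
    unfolding coset_le_iff[OF H] using ray[OF that] linear[of x d] by blast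
  then have "coset_le X (d +o ?H)" if "X \<in> image_mod D ?H" for X
    using that unfolding image_mod_def by blast
  moreover have "d +o ?H \<in> image_mod D ?H" using d by (simp add: image_mod_def)
  ultimately have "is_principal_cut (image_mod UNIV ?H) coset_le (image_mod D ?H) (image_mod E ?H)"
    using principal_cut_if_greatest[OF is_cut_quotient[OF cut refl] antisymp_on_coset_le[OF H]]
    by blast
  with cut show ?thesis by (simp add: ball_cut_def Let_def)
qed

lemma ball_cut_if_upper_ray_mod:
  assumes cut: "is_cut UNIV (\<le>) D E" and e: "e \<in> E"
    and ray: "\<And>e'. e' \<in> E \<Longrightarrow> e' \<le> e \<Longrightarrow> e - e' \<in> invariance_group D"
  shows "ball_cut D E"
proof -
  let ?H = "invariance_group D"
  have H: "convex_subgroup ?H" by (rule convex_subgroup_invariance_group[OF cut])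
  have "coset_le (e +o ?H) (x +o ?H)" if "x \<in> E" for x
    unfolding coset_le_iff[OF H] using ray[OF that] linear[of e x] by blast
  then have "coset_le (e +o ?H) X" if "X \<in> image_mod E ?H" for X
    using that unfolding image_mod_def by blast
  moreover have "e +o ?H \<in> image_mod E ?H" using e by (simp add: image_mod_def)
  ultimately have "is_principal_cut (image_mod UNIV ?H) coset_le (image_mod D ?H) (image_mod E ?H)"
    using principal_cut_if_least[OF is_cut_quotient[OF cut refl] antisymp_on_coset_le[OF H]]
    by blast
  with cut show ?thesis by (simp add: ball_cut_def Let_def)
qed


section \<open>Covariance groups above the invariance group\<close>

lemma Vf_at_mem_convex_above:
  assumes cut: "non_ball_cut D E" and d: "d \<in> D"
  shows "Vf_at D d \<in> convex_above (invariance_group D)"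
proof -
  let ?H = "invariance_group D"
  have c: "is_cut UNIV (\<le>) D E" and nb: "\<not> ball_cut D E"
    using cut by (auto simp: non_ball_cut_def)
  have H: "convex_subgroup ?H" by (rule convex_subgroup_invariance_group[OF c])
  have V: "convex_subgroup (Vf_at D d)" unfolding Vf_at_def by (rule convex_subgroup_hull)
  have gen: "d' - d \<in> Vf_at D d" if "d' \<in> D" "d \<le> d'" for d'
    unfolding Vf_at_def by (rule hull_inc) (use that in blast)
  have "?H \<subseteq> Vf_at D d"
  proof (rule convex_subgroup_subsetI[OF H V])
    fix h assume h: "h \<in> ?H" "0 \<le> h"
    then have "d + h \<in> D" using d unfolding invariance_group_def by blast
    then show "h \<in> Vf_at D d" using gen[of "d + h"] h by simp
  qed
  moreover have "Vf_at D d \<noteq> ?H" using ball_cut_if_lower_ray_mod[OF c d] gen nb by metis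
  ultimately show ?thesis using V unfolding convex_above_def by blast
qed

lemma Vf_opp_at_mem_convex_above:
  assumes cut: "non_ball_cut D E" and e: "e \<in> E"
  shows "Vf_opp_at E e \<in> convex_above (invariance_group D)"
proof -
  let ?H = "invariance_group D"
  have c: "is_cut UNIV (\<le>) D E" and nb: "\<not> ball_cut D E"
    using cut by (auto simp: non_ball_cut_def)
  have H: "convex_subgroup ?H" by (rule convex_subgroup_invariance_group[OF c])
  have V: "convex_subgroup (Vf_opp_at E e)" unfolding Vf_opp_at_def by (rule convex_subgroup_hull)
  have gen: "e - e' \<in> Vf_opp_at E e" if "e' \<in> E" "e' \<le> e" for e'
    unfolding Vf_opp_at_def by (rule hull_inc) (use that in blast)
  have "?H \<subseteq> Vf_opp_at E e"
  proof (rule convex_subgroup_subsetI[OF H V])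
    fix h assume h: "h \<in> ?H" "0 \<le> h"
    have "e - h \<notin> D"
    proof
      assume "e - h \<in> D"
      then have "e - h + h \<in> D" using h(1) unfolding invariance_group_def by blast
      then show False using c e unfolding is_cut_def by auto
    qed
    then have "e - h \<in> E" using c unfolding is_cut_def by blast
    then show "h \<in> Vf_opp_at E e" using gen[of "e - h"] h by simp
  qed
  moreover have "Vf_opp_at E e \<noteq> ?H" using ball_cut_if_upper_ray_mod[OF c e] gen nb by metis
  ultimately show ?thesis using V unfolding convex_above_def by blast
qed

text \<open>A positive translation can only enlarge \<open>D\<close>, so one outside the invariance group must
  push some element of \<open>D\<close> out of \<open>D\<close>.\<close>

lemma translation_crosses_cut:
  assumes cut: "is_cut UNIV (\<le>) D E" and K: "K \<in> convex_above (invariance_group D)"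
  obtains d k where "k \<in> K" "d \<in> D" "d + k \<in> E"
proof -
  let ?H = "invariance_group D"
  have "convex_subgroup K" "\<not> K \<subseteq> ?H" using K by (auto simp: convex_above_def)
  then obtain k where k: "k \<in> K" "0 \<le> k" "k \<notin> ?H"
    using convex_subgroup_subsetI convex_subgroup_invariance_group[OF cut] by blast
  have "D \<subseteq> (\<lambda>d. d + k) ` D"
  proof
    fix d assume "d \<in> D"
    then have "d - k \<in> D" using mem_cut_mono[OF cut] k(2) by simp
    then show "d \<in> (\<lambda>d. d + k) ` D" by (intro image_eqI[where x = "d - k"]) simp_all
  qed
  then obtain d where "d \<in> D" "d + k \<notin> D" using k(3) unfolding invariance_group_def by blast
  moreover from this have "d + k \<in> E" using cut unfolding is_cut_def by blast
  ultimately show thesis using that k(1) by blast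
qed

text \<open>Every generator of either group is a distance between two points of the interval from
  \<open>d\<close> to \<open>d + k\<close>, hence at most \<open>k\<close>.\<close>

lemma covariance_groups_subset_if_crossing:
  assumes cut: "is_cut UNIV (\<le>) D E" and K: "convex_subgroup K"
    and k: "k \<in> K" "d \<in> D" "d + k \<in> E"
  shows "Vf_at D d \<subseteq> K" "Vf_opp_at E (d + k) \<subseteq> K"
proof -
  have le: "x \<le> y" if "x \<in> D" "y \<in> E" for x y
    using cut that unfolding is_cut_def by blast
  have interval: "x \<in> K" if "0 \<le> x" "x \<le> k" for x
    using convex_subgroupD(4)[OF K convex_subgroupD(1)[OF K] k(1) that] .
  show "Vf_at D d \<subseteq> K" unfolding Vf_at_def
  proof (rule hull_minimal)
    show "{d' - d |d'. d' \<in> D \<and> d \<le> d'} \<subseteq> K"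
      using interval le[OF _ k(3)] by (auto simp: diff_le_eq add.commute)
  qed (rule K)
  show "Vf_opp_at E (d + k) \<subseteq> K" unfolding Vf_opp_at_def
  proof (rule hull_minimal)
    show "{d + k - e' |e'. e' \<in> E \<and> e' \<le> d + k} \<subseteq> K"
      using interval le[OF k(2)] by (auto simp: diff_le_eq add.commute)
  qed (rule K)
qed

theorem lemma2p5:
  fixes D E H :: "'a::linordered_ab_group_add set"
  assumes "non_ball_cut D E"
    and "H = invariance_group D"
  shows "(has_convexity_gap D \<longrightarrow>
            H \<subset> Vf D \<and> Vf D = Vi E \<and> Vf_stable D \<and> Vi_stable E) \<and>
         (\<not> has_convexity_gap D \<longrightarrow>
            H = Vf D \<and> Vf D = Vi E \<and> \<not> Vf_stable D \<and> \<not> Vi_stable E)"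
proof -
  let ?I = "\<Inter>(convex_above H)"
  have cut: "is_cut UNIV (\<le>) D E" using assms(1) by (simp add: non_ball_cut_def)
  have aboveD: "Vf_at D d \<in> convex_above H" if "d \<in> D" for d
    using Vf_at_mem_convex_above[OF assms(1) that] assms(2) by simp
  have aboveE: "Vf_opp_at E e \<in> convex_above H" if "e \<in> E" for e
    using Vf_opp_at_mem_convex_above[OF assms(1) that] assms(2) by simp
  have coinitial: "(\<exists>d\<in>D. Vf_at D d \<subseteq> K) \<and> (\<exists>e\<in>E. Vf_opp_at E e \<subseteq> K)"
    if K: "K \<in> convex_above H" for K
  proof -
    obtain d k where dk: "k \<in> K" "d \<in> D" "d + k \<in> E"
      by (rule translation_crosses_cut[OF cut K[unfolded assms(2)]])
    have "convex_subgroup K" using K by (simp add: convex_above_def)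
    from covariance_groups_subset_if_crossing[OF cut this dk] dk show ?thesis by blast
  qed
  have Vf: "Vf D = ?I" unfolding Vf_def
    by (rule coinitial_family_Inter) (use aboveD coinitial in blast)+
  have Vi: "Vi E = ?I" unfolding Vi_def
    by (rule coinitial_family_Inter) (use aboveE coinitial in blast)+
  have stableD: "Vf_stable D \<longleftrightarrow> H \<subset> ?I" unfolding Vf_stable_def Vf_def
    by (rule coinitial_family_attains_iff) (use aboveD coinitial in blast)+
  have stableE: "Vi_stable E \<longleftrightarrow> H \<subset> ?I" unfolding Vi_stable_def Vi_def
    by (rule coinitial_family_attains_iff) (use aboveE coinitial in blast)+
  have gap: "has_convexity_gap D \<longleftrightarrow> H \<subset> ?I"
    using has_convexity_gap_iff[of D] assms(2) by simp
  have "H \<subseteq> ?I" by (auto simp: convex_above_def)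
  then show ?thesis unfolding Vf Vi stableD stableE gap by blast
qed

end
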